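(* Let $g\in L^2(\mathbb{R})$ be real-valued with $\|g\|_2=1$. Let $a,b\in\mathbb{R}$ be nonzero and distinct, and let $\Lambda = \{(0,0),(0,1),(a,0),(b,0)\}$. Then the functions $g(x)$, $e^{2\pi i x}g(x)$, $g(x-a)$, $g(x-b)$ are linearly independent in $L^2(\mathbb{R})$. *)

theory Defs
  imports "HOL-Analysis.Analysis"
begin

end

theory Submission
  imports Defs
begin

text \<open>
  Let \<open>e(x) = exp (2\<pi>ix)\<close> and suppose that \<open>(c1 + c2 e(x)) g(x) + c3 g(x - a) + c4 g(x - b) = 0\<close>.
  If \<open>c2 = 0\<close>, the real and imaginary parts are relations \<open>\<alpha> g + \<beta> T g + \<gamma> S g = 0\<close> with commuting
  translations \<open>T\<close>, \<open>S\<close>. By normality the adjoint relation holds as well, and eliminating \<open>S\<close>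
  gives \<open>\<alpha>\<beta> (T g + T\<^sup>-\<^sup>1 g) = (\<gamma>\<^sup>2 - \<alpha>\<^sup>2 - \<beta>\<^sup>2) g\<close>. Factoring this recurrence produces an eigenfunction of
  a translation in \<open>L\<^sup>2\<close>, which must vanish.

  Let \<open>c2 \<noteq> 0\<close>. If \<open>c3\<close> and \<open>c4\<close> are proportional over the reals, then, \<open>g\<close> being real, taking an
  imaginary part leaves a nonzero trigonometric polynomial times \<open>g\<close>, so \<open>g = 0\<close>. Otherwise the
  imaginary parts give \<open>g(x - a) = A(x) g(x)\<close> and \<open>g(x - b) = B(x) g(x)\<close> with trigonometric polynomials of
  degree one. Computing \<open>g(x - a - b)\<close> in two ways and comparing leading coefficients yields
  \<open>e(a) = e(b)\<close>. Then \<open>n = a - b\<close> is a period of \<open>A\<close> and \<open>B\<close>, and \<open>A(x) g(x + n) = B(x) g(x)\<close>; hence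
  \<open>\<bar>g\<bar>\<close> is monotone along the orbits of the shift by \<open>n\<close>, which is impossible in \<open>L\<^sup>2\<close> unless \<open>g = 0\<close>.
\<close>

section \<open>Translations on the line and integrable functions monotone along their orbits\<close>

lemma AE_lborel_shift:
  fixes t :: real
  assumes "AE x in lborel. P x"
  shows "AE x in lborel. P (x + t)"
proof -
  have "AE x in distr lborel borel ((+) t). P x"
    using assms by (simp only: lborel_distr_plus)
  then have "AE x in lborel. P (t + x)"
    by (rule AE_distrD[rotated]) simp
  then show ?thesis by (simp add: add.commute)
qed

lemma integrable_shift:
  fixes f :: "real \<Rightarrow> real"
  assumes "integrable lborel f"
  shows "integrable lborel (\<lambda>x. f (x + t))"
  using lborel_integrable_real_affine[OF assms, of 1 t] by (simp add: add.commute)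

lemma integral_shift:
  fixes f :: "real \<Rightarrow> real"
  shows "(LINT x|lborel. f (x + t)) = (LINT x|lborel. f x)"
  using lborel_integral_real_affine[of 1 f t] by (simp add: add.commute)

text \<open>Translation preserves the integral, so the nonnegative function
  \<open>h (x + a) - h x\<close> integrates to zero and \<open>h\<close> is periodic almost
  everywhere; integrability then forces \<open>h\<close> to vanish.\<close>

lemma AE_zero_if_shift_mono:
  fixes h :: "real \<Rightarrow> real"
  assumes int: "integrable lborel h" and nonneg: "\<And>x. 0 \<le> h x"
    and mono: "AE x in lborel. h x \<le> h (x + a)" and a: "a \<noteq> 0"
  shows "AE x in lborel. h x = 0"
proof -
  note int_a = integrable_shift[OF int, of a]
  have "AE x in lborel. h (x + a) - h x = 0"
    using mono int int_a
    by (subst integral_nonneg_eq_0_iff_AE[symmetric]) (auto simp: integral_shift)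
  then have per: "AE x in lborel. h (x + a) = h x" by simp
  have [measurable]: "h \<in> borel_measurable borel" using int by (simp add: borel_measurable_integrable[of lborel, simplified])
  \<comment> \<open>The weight \<open>arctan\<close> is bounded, which keeps the product integrable,
    and strictly increasing, which detects the shift.\<close>
  have wint: "integrable lborel (\<lambda>x. h x * arctan (x + c))" for c
  proof (rule Bochner_Integration.integrable_bound[OF integrable_mult_right[OF int, of "pi/2"]])
    show "AE x in lborel. norm (h x * arctan (x + c)) \<le> norm (pi / 2 * h x)"
    proof (intro AE_I2)
      fix x
      have "\<bar>arctan (x + c)\<bar> \<le> pi / 2"
        using arctan_ubound[of "x + c"] arctan_lbound[of "x + c"] by linarith
      then show "norm (h x * arctan (x + c)) \<le> norm (pi / 2 * h x)"
        using mult_right_mono[of "\<bar>arctan (x + c)\<bar>" "pi / 2" "h x"] nonneg[of x]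
        by (simp add: abs_mult mult.commute)
    qed
  qed (measurable)
  \<comment> \<open>A periodic \<open>h\<close> has the same integral against \<open>arctan\<close> and its translate, which differ strictly.\<close>
  have "(LINT x|lborel. h x * arctan x) = (LINT x|lborel. h (x + a) * arctan (x + a))"
    by (rule integral_shift[symmetric])
  also have "\<dots> = (LINT x|lborel. h x * arctan (x + a))"
    using per by (intro integral_cong_AE) auto
  \<comment> \<open>The factor \<open>sgn a\<close> makes the integrand nonnegative for either
    direction of the shift.\<close>
  finally have "(LINT x|lborel. sgn a * (h x * arctan (x + a) - h x * arctan x)) = 0"
    using wint[of a] wint[of 0] by simp
  moreover have pos: "sgn a * (arctan (x + a) - arctan x) > 0" for x
    using a arctan_monotone[of x "x+a"] arctan_monotone[of "x+a" x]
    by (cases "a > 0") (auto simp: sgn_if)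
  have "0 \<le> sgn a * (h x * arctan (x + a) - h x * arctan x)" for x
    using mult_nonneg_nonneg[OF nonneg[of x] less_imp_le[OF pos[of x]]]
    by (simp add: algebra_simps)
  ultimately have "AE x in lborel. sgn a * (h x * arctan (x + a) - h x * arctan x) = 0"
    using wint[of a] wint[of 0]
    by (subst integral_nonneg_eq_0_iff_AE[symmetric]) auto
  then show ?thesis
  proof eventually_elim
    case (elim x)
    then have "h x * (sgn a * (arctan (x + a) - arctan x)) = 0"
      by (simp add: algebra_simps)
    with pos[of x] show ?case by auto
  qed
qed

lemma AE_zero_if_shift_antimono:
  fixes h :: "real \<Rightarrow> real"
  assumes "integrable lborel h" "\<And>x. 0 \<le> h x"
    and mono: "AE x in lborel. h (x + a) \<le> h x" and "a \<noteq> 0"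
  shows "AE x in lborel. h x = 0"
  using AE_lborel_shift[OF mono, of "-a"] assms
  by (intro AE_zero_if_shift_mono[where a="-a"]) auto

text \<open>Each shift scales the squared modulus of \<open>f\<close> by that of
  \<open>\<mu>\<close>, so it is monotone along orbits, in a direction decided by comparing
  \<open>cmod \<mu>\<close> with 1.\<close>

lemma shift_eigenfunction_AE_zero:
  fixes f :: "real \<Rightarrow> complex"
  assumes int: "integrable lborel (\<lambda>x. (cmod (f x))\<^sup>2)"
    and eig: "AE x in lborel. f (x + a) = \<mu> * f x" and "a \<noteq> 0"
  shows "AE x in lborel. f x = 0"
proof -
  have "AE x in lborel. (cmod (f x))\<^sup>2 = 0"
  proof (cases "cmod \<mu> \<ge> 1")
    case True
    have "AE x in lborel. (cmod (f x))\<^sup>2 \<le> (cmod (f (x + a)))\<^sup>2"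
      using eig
    proof eventually_elim
      case (elim x)
      show ?case unfolding elim norm_mult power_mult_distrib
        using mult_right_mono[of 1 "(cmod \<mu>)\<^sup>2" "(cmod (f x))\<^sup>2"] True by (simp add: one_le_power)
    qed
    with assms show ?thesis by (intro AE_zero_if_shift_mono[where a=a]) auto
  next
    case False
    have "AE x in lborel. (cmod (f (x + a)))\<^sup>2 \<le> (cmod (f x))\<^sup>2"
      using eig
    proof eventually_elim
      case (elim x)
      show ?case unfolding elim norm_mult power_mult_distrib
        using False by (intro mult_left_le_one_le) (auto simp: power_le_one)
    qed
    with assms show ?thesis by (intro AE_zero_if_shift_antimono[where a=a]) auto
  qed
  then show ?thesis by simp
qed

section \<open>Independence of two and three translates of a real square-integrable function\<close>

context
  fixes g :: "real \<Rightarrow> real"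
  assumes meas [measurable]: "g \<in> borel_measurable borel"
    and L2: "integrable lborel (\<lambda>x. (g x)\<^sup>2)"
begin

lemma integrable_shift_mult_shift: "integrable lborel (\<lambda>x. g (x + s) * g (x + t))"
proof (rule Bochner_Integration.integrable_bound)
  show "integrable lborel (\<lambda>x. (g (x + s))\<^sup>2 + (g (x + t))\<^sup>2)"
    using integrable_shift[OF L2] by auto
  show "AE x in lborel. norm (g (x + s) * g (x + t)) \<le> norm ((g (x + s))\<^sup>2 + (g (x + t))\<^sup>2)"
  proof (intro AE_I2)
    fix x
    have "2 * \<bar>g (x + s)\<bar> * \<bar>g (x + t)\<bar> \<le> \<bar>g (x + s)\<bar>\<^sup>2 + \<bar>g (x + t)\<bar>\<^sup>2"
      by (rule sum_squares_bound)
    moreover have "0 \<le> \<bar>g (x + s)\<bar> * \<bar>g (x + t)\<bar>" by simp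
    ultimately show "norm (g (x + s) * g (x + t)) \<le> norm ((g (x + s))\<^sup>2 + (g (x + t))\<^sup>2)"
      unfolding real_norm_def abs_mult power2_abs by linarith
  qed
qed measurable

lemma integral_shift_mult_shift:
  "(LINT x|lborel. g (x + s) * g (x + t)) = (LINT x|lborel. g x * g (x + (t - s)))"
  using integral_shift[of "\<lambda>x. g x * g (x + (t - s))" s] by (simp add: algebra_simps)

lemma autocorrelation_even: "(LINT x|lborel. g x * g (x + (- s))) = (LINT x|lborel. g x * g (x + s))"
  using integral_shift_mult_shift[of s 0] by (simp add: mult.commute)

lemma integrable_square_combination:
  "integrable lborel (\<lambda>x. (\<alpha> * g x + \<beta> * g (x + s) + \<gamma> * g (x + t))\<^sup>2)"
proof -
  note I = integrable_shift_mult_shift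
  \<comment> \<open>Writing \<open>g (x+0)\<close> for \<open>g x\<close> makes every product an
    instance of \<open>integrable_shift_mult_shift\<close>.\<close>
  have eq: "(\<lambda>x. (\<alpha> * g x + \<beta> * g (x + s) + \<gamma> * g (x + t))\<^sup>2) =
     (\<lambda>x. \<alpha>\<^sup>2 * (g (x+0) * g (x+0)) + \<beta>\<^sup>2 * (g (x+s) * g (x+s)) + \<gamma>\<^sup>2 * (g (x+t) * g (x+t))
       + 2 * \<alpha> * \<beta> * (g (x+0) * g (x+s)) + 2 * \<alpha> * \<gamma> * (g (x+0) * g (x+t)) + 2 * \<beta> * \<gamma> * (g (x+s) * g (x+t)))"
    by (auto simp: power2_eq_square algebra_simps)
  show ?thesis unfolding eq
    by (intro Bochner_Integration.integrable_add integrable_mult_right I)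
qed

lemma integral_square_combination:
  "(LINT x|lborel. (\<alpha> * g x + \<beta> * g (x + s) + \<gamma> * g (x + t))\<^sup>2) =
     (\<alpha>\<^sup>2 + \<beta>\<^sup>2 + \<gamma>\<^sup>2) * (LINT x|lborel. g x * g x) + 2 * \<alpha> * \<beta> * (LINT x|lborel. g x * g (x + s))
     + 2 * \<alpha> * \<gamma> * (LINT x|lborel. g x * g (x + t)) + 2 * \<beta> * \<gamma> * (LINT x|lborel. g x * g (x + (t - s)))"
proof -
  note I = integrable_shift_mult_shift
  have eq: "(\<lambda>x. (\<alpha> * g x + \<beta> * g (x + s) + \<gamma> * g (x + t))\<^sup>2) =
     (\<lambda>x. \<alpha>\<^sup>2 * (g (x+0) * g (x+0)) + \<beta>\<^sup>2 * (g (x+s) * g (x+s)) + \<gamma>\<^sup>2 * (g (x+t) * g (x+t))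
       + 2 * \<alpha> * \<beta> * (g (x+0) * g (x+s)) + 2 * \<alpha> * \<gamma> * (g (x+0) * g (x+t)) + 2 * \<beta> * \<gamma> * (g (x+s) * g (x+t)))"
    by (auto simp: power2_eq_square algebra_simps)
  show ?thesis unfolding eq
    by (simp only: Bochner_Integration.integral_add Bochner_Integration.integrable_add
        integrable_mult_right integral_mult_right_zero I integral_shift_mult_shift)
      (simp add: algebra_simps)
qed

text \<open>A polynomial in translations is a normal operator, so it has the same kernel as its adjoint.\<close>

lemma translates_relation_adjoint:
  assumes "AE x in lborel. \<alpha> * g x + \<beta> * g (x + s) + \<gamma> * g (x + t) = 0"
  shows "AE x in lborel. \<alpha> * g x + \<beta> * g (x - s) + \<gamma> * g (x - t) = 0"
proof -
  \<comment> \<open>Normality in concrete form: both norms expand into autocorrelations of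
    \<open>g\<close>, which are even, so negating both shifts changes nothing.\<close>
  have "(LINT x|lborel. (\<alpha> * g x + \<beta> * g (x + (- s)) + \<gamma> * g (x + (- t)))\<^sup>2)
      = (LINT x|lborel. (\<alpha> * g x + \<beta> * g (x + s) + \<gamma> * g (x + t))\<^sup>2)"
    unfolding integral_square_combination autocorrelation_even
    using autocorrelation_even[of "t - s"] by simp
  also have "\<dots> = 0"
    using assms by (intro integral_eq_zero_AE) simp
  finally have "(LINT x|lborel. (\<alpha> * g x + \<beta> * g (x + (- s)) + \<gamma> * g (x + (- t)))\<^sup>2) = 0" by simp
  then have "AE x in lborel. (\<alpha> * g x + \<beta> * g (x + (- s)) + \<gamma> * g (x + (- t)))\<^sup>2 = 0"
    using integrable_square_combination[of \<alpha> \<beta> "- s" \<gamma> "- t"]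
    by (subst (asm) integral_nonneg_eq_0_iff_AE) auto
  then show ?thesis by simp
qed

text \<open>With \<open>T\<close> the shift by \<open>a\<close> and \<open>\<rho>\<close>,
  \<open>\<sigma>\<close> the possibly nonreal roots of \<open>z^2 - c z + 1\<close>, the recurrence
  factors as \<open>(T - \<sigma>) (T - \<rho>) g = 0\<close>. Thus
  \<open>w = (T - \<rho>) g\<close> is an eigenfunction of \<open>T\<close> and vanishes, and then
  so does \<open>g\<close>.\<close>

lemma three_term_recurrence_AE_zero:
  assumes rec: "AE x in lborel. g (x + a) + g (x - a) = c * g x" and a: "a \<noteq> 0"
  shows "AE x in lborel. g x = 0"
proof -
  define \<rho> where "\<rho> = (of_real c + csqrt ((of_real c)\<^sup>2 - 4)) / 2"
  define \<sigma> where "\<sigma> = of_real c - \<rho>"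
  have sum: "of_real c = \<rho> + \<sigma>" by (simp add: \<sigma>_def)
  have prod: "\<rho> * \<sigma> = 1"
  proof -
    have "4 * (\<rho> * \<sigma>) = (of_real c)\<^sup>2 - (csqrt ((of_real c)\<^sup>2 - 4))\<^sup>2"
      unfolding \<sigma>_def \<rho>_def by (simp add: field_simps power2_eq_square)
    then show ?thesis by simp
  qed
  define w where "w x = of_real (g (x + a)) - \<rho> * of_real (g x)" for x
  have "AE x in lborel. w (x + a) = \<sigma> * w x"
    using AE_lborel_shift[OF rec, of a]
  proof eventually_elim
    case (elim x)
    then have "g (x + a + a) = c * g (x + a) - g x" by simp
    then have "w (x + a) = (\<rho> + \<sigma>) * of_real (g (x + a)) - (\<rho> * \<sigma>) * of_real (g x) - \<rho> * of_real (g (x + a))"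
      unfolding w_def by (simp add: sum[symmetric] prod)
    then show ?case by (simp add: w_def algebra_simps)
  qed
  moreover have "integrable lborel (\<lambda>x. (cmod (w x))\<^sup>2)"
  proof -
    \<comment> \<open>Zero coefficients pad the real and imaginary parts to the shape of
      \<open>integrable_square_combination\<close>.\<close>
    have "(cmod (w x))\<^sup>2 = (- Re \<rho> * g x + 1 * g (x + a) + 0 * g (x + 0))\<^sup>2 + (Im \<rho> * g x + 0 * g (x + 0) + 0 * g (x + 0))\<^sup>2" for x
      unfolding cmod_power2 w_def by (simp add: algebra_simps power_mult_distrib)
    then show ?thesis
      by (simp only: Bochner_Integration.integrable_add integrable_square_combination)
  qed
  ultimately have "AE x in lborel. w x = 0"
    using a by (intro shift_eigenfunction_AE_zero[of w a \<sigma>])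
  then have "AE x in lborel. complex_of_real (g (x + a)) = \<rho> * of_real (g x)"
    by (simp add: w_def)
  then have "AE x in lborel. complex_of_real (g x) = 0"
    using L2 a by (intro shift_eigenfunction_AE_zero[of _ a \<rho>]) auto
  then show ?thesis by simp
qed

lemma two_translates_independent:
  assumes nz: "\<not> (AE x in lborel. g x = 0)" and "s \<noteq> t"
    and rel: "AE x in lborel. \<alpha> * g (x + s) + \<beta> * g (x + t) = 0"
  shows "\<alpha> = 0 \<and> \<beta> = 0"
proof (rule ccontr)
  assume *: "\<not> ?thesis"
  \<comment> \<open>Solving for the second translate makes \<open>g\<close> an eigenfunction of the
    shift by \<open>t - s\<close>. The claim is general so that it also applies with the two terms
    exchanged.\<close>
  have False if "\<beta> \<noteq> 0" "s \<noteq> t" "AE x in lborel. \<alpha> * g (x + s) + \<beta> * g (x + t) = 0" for \<alpha> \<beta> s t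
  proof -
    have eig: "AE x in lborel. complex_of_real (g (x + (t - s))) = of_real (- \<alpha> / \<beta>) * of_real (g x)"
      using AE_lborel_shift[OF that(3), of "-s"]
    proof eventually_elim
      case (elim x)
      then have "g (x + (t - s)) = (- \<alpha> / \<beta>) * g x"
        using that by (simp add: field_simps)
      then show ?case by (simp only: of_real_mult)
    qed
    have "AE x in lborel. complex_of_real (g x) = 0"
      using L2 that by (intro shift_eigenfunction_AE_zero[OF _ eig]) auto
    with nz show False by simp
  qed
  from this[of \<beta> s t \<alpha>] this[of \<alpha> t s \<beta>] * assms show False
    by (auto simp: add.commute)
qed

lemma three_translates_independent:
  assumes nz: "\<not> (AE x in lborel. g x = 0)" and "s \<noteq> 0" "t \<noteq> 0" "s \<noteq> t"
    and rel: "AE x in lborel. \<alpha> * g x + \<beta> * g (x + s) + \<gamma> * g (x + t) = 0"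
  shows "\<alpha> = 0 \<and> \<beta> = 0 \<and> \<gamma> = 0"
proof -
  have "\<alpha> * \<beta> = 0"
  proof (rule ccontr)
    assume "\<alpha> * \<beta> \<noteq> 0"
    have "AE x in lborel. g (x + s) + g (x - s) = ((\<gamma>\<^sup>2 - \<alpha>\<^sup>2 - \<beta>\<^sup>2) / (\<alpha> * \<beta>)) * g x"
      using rel AE_lborel_shift[OF rel, of "-s"]
        AE_lborel_shift[OF translates_relation_adjoint[OF rel], of t]
    proof eventually_elim
      case (elim x)
      then have eqs: "\<alpha> * g x + \<beta> * g (x + s) + \<gamma> * g (x + t) = 0"
          "\<alpha> * g (x - s) + \<beta> * g x + \<gamma> * g (x + t - s) = 0"
          "\<alpha> * g (x + t) + \<beta> * g (x + t - s) + \<gamma> * g x = 0"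
        by (simp_all add: algebra_simps)
      \<comment> \<open>The multipliers \<open>\<alpha>\<close>, \<open>\<beta>\<close>,
        \<open>- \<gamma>\<close> are chosen to cancel \<open>g (x + t)\<close> and
        \<open>g (x + t - s)\<close>.\<close>
      have "(\<alpha> * \<beta>) * (g (x + s) + g (x - s)) - (\<gamma>\<^sup>2 - \<alpha>\<^sup>2 - \<beta>\<^sup>2) * g x
          = \<alpha> * (\<alpha> * g x + \<beta> * g (x + s) + \<gamma> * g (x + t))
            + \<beta> * (\<alpha> * g (x - s) + \<beta> * g x + \<gamma> * g (x + t - s))
            - \<gamma> * (\<alpha> * g (x + t) + \<beta> * g (x + t - s) + \<gamma> * g x)"
        by (simp add: power2_eq_square algebra_simps)
      also have "\<dots> = 0" unfolding eqs by simp
      finally have "(\<alpha> * \<beta>) * (g (x + s) + g (x - s)) = (\<gamma>\<^sup>2 - \<alpha>\<^sup>2 - \<beta>\<^sup>2) * g x"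
        by simp
      with \<open>\<alpha> * \<beta> \<noteq> 0\<close> show ?case by (simp add: field_simps)
    qed
    from three_term_recurrence_AE_zero[OF this \<open>s \<noteq> 0\<close>] nz show False by simp
  qed
  then consider "\<alpha> = 0" | "\<beta> = 0" by auto
  then show ?thesis
  proof cases
    case 1
    with rel have "AE x in lborel. \<beta> * g (x + s) + \<gamma> * g (x + t) = 0" by simp
    with two_translates_independent[OF nz \<open>s \<noteq> t\<close>] 1 show ?thesis by blast
  next
    case 2
    with rel have "AE x in lborel. \<alpha> * g (x + 0) + \<gamma> * g (x + t) = 0" by simp
    with two_translates_independent[OF nz \<open>t \<noteq> 0\<close>[symmetric]] 2 show ?thesis by blast
  qed
qed

end

section \<open>Zeros of trigonometric polynomials\<close>

text \<open>The body has exactly the form of the exponential in the final statement, so that it can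
  be folded there.\<close>

definition e2pi :: "real \<Rightarrow> complex" where
  "e2pi x = exp (2 * pi * \<i> * complex_of_real x)"

lemma e2pi_eq_cis: "e2pi x = cis (2 * pi * x)"
  by (simp add: e2pi_def cis_conv_exp mult_ac)

lemma e2pi_add: "e2pi (x + y) = e2pi x * e2pi y"
  by (simp add: e2pi_eq_cis cis_mult algebra_simps)

lemma e2pi_minus: "e2pi (- x) = cnj (e2pi x)"
  by (simp add: e2pi_eq_cis cis_cnj)

lemma e2pi_nonzero [simp]: "e2pi x \<noteq> 0"
  by (simp add: e2pi_def)

lemma e2pi_mult_cnj [simp]: "e2pi x * cnj (e2pi x) = 1"
  by (simp add: e2pi_eq_cis flip: complex_norm_square)

lemma measurable_e2pi [measurable]: "e2pi \<in> borel_measurable borel"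
  unfolding e2pi_def by (intro borel_measurable_continuous_onI continuous_intros)

lemma countable_e2pi_vimage: "countable {x. e2pi x = w}"
proof (cases "\<exists>y. e2pi y = w")
  case True
  then obtain y where y: "e2pi y = w" by blast
  have "{x. e2pi x = w} \<subseteq> (\<lambda>n. y + of_int n) ` UNIV"
  proof
    fix x assume "x \<in> {x. e2pi x = w}"
    then have "e2pi x = e2pi y" using y by simp
    then obtain n where "2 * pi * \<i> * complex_of_real x = 2 * pi * \<i> * complex_of_real y + (of_int (2 * n) * pi) * \<i>"
      unfolding e2pi_def exp_eq by blast
    then have "(2 * pi * \<i>) * complex_of_real x = (2 * pi * \<i>) * of_real (y + of_int n)"
      by (simp add: algebra_simps)
    then have "complex_of_real x = of_real (y + of_int n)"
      by (subst (asm) mult_cancel_left) auto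
    then have "x = y + of_int n" by (simp only: of_real_eq_iff)
    then show "x \<in> (\<lambda>n. y + of_int n) ` UNIV" by blast
  qed
  then show ?thesis by (rule countable_subset) simp
qed simp

text \<open>\<open>P\<close> has finitely many roots, each with a countable preimage under
  \<open>e2pi\<close>, so the exceptional set is countable.\<close>

lemma AE_poly_e2pi_nonzero:
  assumes "P \<noteq> 0"
  shows "AE x in lborel. poly P (e2pi x) \<noteq> 0"
proof -
  have "{x. poly P (e2pi x) = 0} = (\<Union>w\<in>{w. poly P w = 0}. {x. e2pi x = w})" by auto
  also have "countable \<dots>"
    using poly_roots_finite[OF assms]
    by (intro countable_UN countable_finite countable_e2pi_vimage)
  finally have "{x. poly P (e2pi x) = 0} \<in> null_sets lborel"
    by (rule countable_imp_null_set_lborel)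
  then show ?thesis by (rule AE_I') auto
qed

text \<open>On the unit circle conjugation is inversion, so the extra factor \<open>e2pi x\<close>
  clears the negative power in \<open>w - cnj w\<close> and leaves a quadratic in
  \<open>e2pi x\<close>.\<close>

lemma Im_trig_eq_poly:
  "2 * \<i> * of_real (Im (p + q * e2pi x)) * e2pi x = poly [:- cnj q, p - cnj p, q:] (e2pi x)"
proof -
  have Im_w: "2 * \<i> * of_real (Im w) = w - cnj w" for w
    by (simp add: complex_eq_iff)
  have "2 * \<i> * of_real (Im (p + q * e2pi x)) * e2pi x
      = (p + q * e2pi x) * e2pi x - cnj p * e2pi x - cnj q * (e2pi x * cnj (e2pi x))"
    unfolding Im_w by (simp add: algebra_simps del: e2pi_mult_cnj)
  then show ?thesis by (simp add: algebra_simps)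
qed

lemma AE_Im_trig_nonzero:
  assumes "q \<noteq> 0"
  shows "AE x in lborel. Im (p + q * e2pi x) \<noteq> 0"
proof -
  have "[:- cnj q, p - cnj p, q:] \<noteq> 0" using assms by simp
  from AE_poly_e2pi_nonzero[OF this] show ?thesis
    unfolding Im_trig_eq_poly[symmetric]
    by eventually_elim (metis mult_zero_left mult_zero_right of_real_0)
qed

text \<open>Up to nonzero factors the difference of the two sides is a quartic in
  \<open>e2pi x\<close>. The shifts multiply the leading coefficients by \<open>e2pi (- b)\<close>
  and \<open>e2pi (- a)\<close>, so the top coefficient is
  \<open>q * r * (e2pi (- b) - e2pi (- a))\<close>.\<close>

lemma AE_Im_trig_commutator_nonzero:
  assumes "q \<noteq> 0" "r \<noteq> 0" "e2pi a \<noteq> e2pi b"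
  shows "AE x in lborel. Im (p + q * e2pi (x - b)) * Im (s + r * e2pi x)
    \<noteq> Im (s + r * e2pi (x - a)) * Im (p + q * e2pi x)"
proof -
  define qb where "qb = q * e2pi (- b)"
  define ra where "ra = r * e2pi (- a)"
  define P where "P = [:- cnj qb, p - cnj p, qb:] * [:- cnj r, s - cnj s, r:]
     - [:- cnj ra, s - cnj s, ra:] * [:- cnj q, p - cnj p, q:]"
  have "coeff P 4 = qb * r - ra * q"
    by (simp add: P_def numeral_eq_Suc)
  also have "\<dots> = q * r * (e2pi (- b) - e2pi (- a))" by (simp add: qb_def ra_def algebra_simps)
  also have "\<dots> \<noteq> 0" using assms by (simp add: e2pi_minus)
  finally have "P \<noteq> 0" by auto
  from AE_poly_e2pi_nonzero[OF this] show ?thesis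
  proof eventually_elim
    case (elim x)
    have sh: "q * e2pi (x - b) = qb * e2pi x" "r * e2pi (x - a) = ra * e2pi x"
      using e2pi_add[of x "-b"] e2pi_add[of x "-a"] by (simp_all add: qb_def ra_def)
    show ?case
    proof
      assume *: "Im (p + q * e2pi (x - b)) * Im (s + r * e2pi x)
        = Im (s + r * e2pi (x - a)) * Im (p + q * e2pi x)"
      have "poly P (e2pi x) = (2 * \<i> * e2pi x)\<^sup>2 *
         (of_real (Im (p + q * e2pi (x - b)) * Im (s + r * e2pi x))
           - of_real (Im (s + r * e2pi (x - a)) * Im (p + q * e2pi x)))"
        unfolding P_def poly_diff poly_mult Im_trig_eq_poly[symmetric] sh of_real_mult
        by (simp only: power2_eq_square right_diff_distrib mult_ac)
      also have "\<dots> = 0" unfolding * by simp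
      finally show False using elim by simp
    qed
  qed
qed

section \<open>Vanishing of the modulation coefficient\<close>

text \<open>Since \<open>A\<close> and \<open>B\<close> have period \<open>n\<close>, the set
  \<open>E\<close> is invariant under the shift. The square of \<open>g\<close> is nondecreasing
  along orbits in \<open>E\<close> and nonincreasing along the others, so it vanishes on both
  pieces.\<close>

lemma periodic_cocycle_AE_zero:
  fixes g A B :: "real \<Rightarrow> real"
  assumes [measurable]: "g \<in> borel_measurable borel" "A \<in> borel_measurable borel" "B \<in> borel_measurable borel"
    and L2: "integrable lborel (\<lambda>x. (g x)\<^sup>2)" and n: "n \<noteq> 0"
    and perA: "\<And>x. A (x + n) = A x" and perB: "\<And>x. B (x + n) = B x"
    and rel: "AE x in lborel. A x * g (x + n) = B x * g x"
    and A: "AE x in lborel. A x \<noteq> 0"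
  shows "AE x in lborel. g x = 0"
proof -
  define E where "E = {x. (A x)\<^sup>2 \<le> (B x)\<^sup>2}"
  have [measurable]: "E \<in> sets borel" unfolding E_def by measurable
  have E: "x + n \<in> E \<longleftrightarrow> x \<in> E" for x by (simp add: E_def perA perB)
  have sq: "AE x in lborel. A x \<noteq> 0 \<and> (A x)\<^sup>2 * (g (x + n))\<^sup>2 = (B x)\<^sup>2 * (g x)\<^sup>2"
    using rel A by eventually_elim (metis power_mult_distrib)
  have int: "integrable lborel (\<lambda>x. indicator F x * (g x)\<^sup>2)" if "F \<in> sets borel" for F :: "real set"
    using integrable_mult_indicator[OF _ L2, of F] that by simp
  have "AE x in lborel. indicator E x * (g x)\<^sup>2 = 0"
  proof (rule AE_zero_if_shift_mono[OF int _ _ n])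
    show "AE x in lborel. indicator E x * (g x)\<^sup>2 \<le> indicator E (x + n) * (g (x + n))\<^sup>2"
      using sq
    proof eventually_elim
      case (elim x)
      have "(g x)\<^sup>2 \<le> (g (x + n))\<^sup>2" if "x \<in> E"
      proof -
        have "(A x)\<^sup>2 * (g x)\<^sup>2 \<le> (A x)\<^sup>2 * (g (x + n))\<^sup>2"
          using that elim by (auto simp: E_def intro: mult_right_mono)
        then show ?thesis using elim by (subst (asm) mult_le_cancel_left_pos) auto
      qed
      then show ?case by (auto simp: indicator_def E)
    qed
  qed auto
  moreover have "AE x in lborel. indicator (- E) x * (g x)\<^sup>2 = 0"
  proof (rule AE_zero_if_shift_antimono[OF int _ _ n])
    show "AE x in lborel. indicator (- E) (x + n) * (g (x + n))\<^sup>2 \<le> indicator (- E) x * (g x)\<^sup>2"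
      using sq
    proof eventually_elim
      case (elim x)
      have "(g (x + n))\<^sup>2 \<le> (g x)\<^sup>2" if "x \<notin> E"
      proof -
        have "(A x)\<^sup>2 * (g (x + n))\<^sup>2 \<le> (A x)\<^sup>2 * (g x)\<^sup>2"
          using that elim by (auto simp: E_def intro: mult_right_mono)
        then show ?thesis using elim by (subst (asm) mult_le_cancel_left_pos) auto
      qed
      then show ?case by (auto simp: indicator_def E)
    qed
  qed auto
  ultimately show ?thesis
    by eventually_elim (auto simp: indicator_def split: if_splits)
qed

text \<open>Multiplication by \<open>cnj c4\<close> makes the coefficient of \<open>w\<close> real;
  as \<open>u\<close>, \<open>v\<close>, \<open>w\<close> are real, the imaginary part loses
  \<open>w\<close>.\<close>

lemma eliminate_translate:
  assumes "c1 * complex_of_real u + c2 * (e * complex_of_real u)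
     + c3 * complex_of_real v + c4 * complex_of_real w = 0"
  shows "Im (cnj c4 * c1 + cnj c4 * c2 * e) * u + Im (cnj c4 * c3) * v = 0"
proof -
  have "cnj c4 * (c1 * of_real u + c2 * (e * of_real u) + c3 * of_real v + c4 * of_real w)
     = of_real u * (cnj c4 * c1 + cnj c4 * c2 * e) + of_real v * (cnj c4 * c3) + of_real w * (cnj c4 * c4)"
    by (simp add: algebra_simps)
  then have "Im (of_real u * (cnj c4 * c1 + cnj c4 * c2 * e) + of_real v * (cnj c4 * c3) + of_real w * (cnj c4 * c4)) = 0"
    using assms by simp
  then have "u * Im (cnj c4 * c1 + cnj c4 * c2 * e) + v * Im (cnj c4 * c3) + w * Im (cnj c4 * c4) = 0"
    by (simp only: Im_complex_of_real Re_complex_of_real plus_complex.sel times_complex.sel mult_zero_left add_0_right)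
  moreover have "Im (cnj c4 * c4) = 0" by simp
  ultimately show ?thesis by (simp only: mult.commute mult_zero_right add_0_right)
qed

lemma hrt_modulation_coeff_zero:
  fixes g :: "real \<Rightarrow> real"
  assumes [measurable]: "g \<in> borel_measurable borel" and L2: "integrable lborel (\<lambda>x. (g x)\<^sup>2)"
    and nz: "\<not> (AE x in lborel. g x = 0)" and ab: "a \<noteq> b"
    and rel: "AE x in lborel. c1 * complex_of_real (g x) + c2 * (e2pi x * complex_of_real (g x))
      + c3 * complex_of_real (g (x - a)) + c4 * complex_of_real (g (x - b)) = 0"
  shows "c2 = 0"
proof (rule ccontr)
  assume c2: "c2 \<noteq> 0"
  have zero: False if "AE x in lborel. Im (p + q * e2pi x) * g x = 0" "q \<noteq> 0" for p q
  proof -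
    have "AE x in lborel. g x = 0"
      using that(1) AE_Im_trig_nonzero[OF that(2), of p] by eventually_elim auto
    with nz show False by simp
  qed
  \<comment> \<open>Exchanging the last two terms lets the same elimination remove
    \<open>g (x - a)\<close> instead.\<close>
  have rel': "AE x in lborel. c1 * complex_of_real (g x) + c2 * (e2pi x * complex_of_real (g x))
      + c4 * complex_of_real (g (x - b)) + c3 * complex_of_real (g (x - a)) = 0"
    using rel by eventually_elim (simp add: algebra_simps)
  have relA: "AE x in lborel. Im (cnj c4 * c1 + cnj c4 * c2 * e2pi x) * g x + Im (cnj c4 * c3) * g (x - a) = 0"
    using rel by eventually_elim (rule eliminate_translate)
  have relB: "AE x in lborel. Im (cnj c3 * c1 + cnj c3 * c2 * e2pi x) * g x + Im (cnj c3 * c4) * g (x - b) = 0"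
    using rel' by eventually_elim (rule eliminate_translate)
  \<comment> \<open>\<open>d\<close> vanishes exactly when \<open>c3\<close> and \<open>c4\<close>
    are linearly dependent over the reals.\<close>
  define d where "d = Im (cnj c4 * c3)"
  have d': "Im (cnj c3 * c4) = - d" by (simp add: d_def)
  show False
  proof (cases "d = 0")
    case True
    then have 0: "Im (cnj c4 * c3) = 0" "Im (cnj c3 * c4) = 0" using d' by (simp_all only: d_def)
    show False
    proof (cases "c3 = 0 \<and> c4 = 0")
      case True
      have "AE x in lborel. Im (c1 + c2 * e2pi x) * g x = 0"
        using rel
      proof eventually_elim
        case (elim x)
        then have "(c1 + c2 * e2pi x) * of_real (g x) = 0" using True by (simp add: algebra_simps)
        then show ?case by (metis mult_eq_0_iff of_real_eq_0_iff zero_complex.sel(2))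
      qed
      from zero[OF this c2] show False .
    next
      case False
      \<comment> \<open>Whichever of \<open>c3\<close>, \<open>c4\<close> is nonzero gives a
        relation with nonzero leading coefficient \<open>cnj c3 * c2\<close> or
        \<open>cnj c4 * c2\<close>, and its translate term drops out because
        \<open>d = 0\<close>.\<close>
      then show False
        using zero[of "cnj c4 * c1" "cnj c4 * c2"] zero[of "cnj c3 * c1" "cnj c3 * c2"] c2
          relA[unfolded 0] relB[unfolded 0] by auto
    qed
  next
    case d: False
    then have c34: "c3 \<noteq> 0" "c4 \<noteq> 0" by (auto simp: d_def)
    define A where "A x = Im (cnj c4 * c1 + cnj c4 * c2 * e2pi x)" for x
    define B where "B x = Im (cnj c3 * c1 + cnj c3 * c2 * e2pi x)" for x
    have [measurable]: "A \<in> borel_measurable borel" "B \<in> borel_measurable borel"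
      unfolding A_def B_def by measurable
    have gA: "AE x in lborel. A x * g x = - d * g (x - a)"
      using relA unfolding d_def[symmetric] A_def[symmetric] by eventually_elim simp
    have gB: "AE x in lborel. B x * g x = d * g (x - b)"
      using relB unfolding d' B_def[symmetric] by eventually_elim simp
    \<comment> \<open>Both sides equal \<open>- d * d * g (x - a - b)\<close>, reached by the two
      orders of shifting.\<close>
    have comm: "AE x in lborel. A (x - b) * B x * g x = B (x - a) * A x * g x"
      using gA gB AE_lborel_shift[OF gA, of "-b"] AE_lborel_shift[OF gB, of "-a"]
    proof eventually_elim
      case (elim x)
      have "A (x - b) * B x * g x = d * (A (x - b) * g (x - b))"
        using elim(2) by (simp add: algebra_simps)
      also have "\<dots> = - d * d * g (x - a - b)"
        using elim(3) by (simp add: algebra_simps)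
      also have "\<dots> = - d * (B (x - a) * g (x - a))"
        using elim(4) by (simp add: algebra_simps)
      also have "\<dots> = B (x - a) * (A x * g x)"
        unfolding elim(1) by simp
      finally show ?case by (simp only: mult.assoc)
    qed
    have eab: "e2pi a = e2pi b"
    proof (rule ccontr)
      assume ne: "e2pi a \<noteq> e2pi b"
      have "AE x in lborel. A (x - b) * B x \<noteq> B (x - a) * A x"
        unfolding A_def B_def
        by (rule AE_Im_trig_commutator_nonzero[OF _ _ ne]) (use c2 c34 in auto)
      with comm have "AE x in lborel. g x = 0" by eventually_elim auto
      with nz show False by simp
    qed
    define n where "n = a - b"
    have n: "n \<noteq> 0" using ab by (simp add: n_def)
    have per: "e2pi (x + n) = e2pi x" for x
      using e2pi_add[of "x - b" a] e2pi_add[of "x - b" b] eab by (simp add: n_def algebra_simps)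
    \<comment> \<open>Shifting the relation for \<open>A\<close> by \<open>n\<close> turns
      \<open>g (x - a)\<close> into \<open>g (x - b)\<close>, so both sides equal
      \<open>d * g (x - b)\<close>.\<close>
    have "AE x in lborel. (- A x) * g (x + n) = B x * g x"
      using AE_lborel_shift[OF gA, of n] gB
    proof eventually_elim
      case (elim x)
      have "g (x + n - a) = g (x - b)" by (simp add: n_def)
      moreover have "A (x + n) = A x" by (simp only: A_def per)
      ultimately show ?case using elim by simp
    qed
    moreover have "AE x in lborel. - A x \<noteq> 0"
      using AE_Im_trig_nonzero[of "cnj c4 * c2" "cnj c4 * c1"] c2 c34 by (simp only: A_def neg_equal_0_iff_equal) simp
    ultimately have "AE x in lborel. g x = 0"
      using L2 n by (intro periodic_cocycle_AE_zero[where A="\<lambda>x. - A x" and B=B and n=n]) (auto simp: A_def B_def per)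
    with nz show False by simp
  qed
qed

theorem theorem3p6:
  fixes g :: "real \<Rightarrow> real" and a b :: real
  assumes g_meas: "g \<in> borel_measurable lborel"
    and g_L2: "integrable lborel (\<lambda>x. (g x)\<^sup>2)"
    and g_norm: "(LINT x|lborel. (g x)\<^sup>2) = 1"
    and "a \<noteq> 0" and "b \<noteq> 0" and "a \<noteq> b"
  shows "\<forall>c1 c2 c3 c4 :: complex.
           (AE x in lborel.
              c1 * complex_of_real (g x)
            + c2 * (exp (2 * pi * \<i> * complex_of_real x) * complex_of_real (g x))
            + c3 * complex_of_real (g (x - a))
            + c4 * complex_of_real (g (x - b)) = 0)
           \<longrightarrow> c1 = 0 \<and> c2 = 0 \<and> c3 = 0 \<and> c4 = 0"
proof (intro allI impI)
  fix c1 c2 c3 c4 :: complex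
  assume rel: "AE x in lborel.
              c1 * complex_of_real (g x)
            + c2 * (exp (2 * pi * \<i> * complex_of_real x) * complex_of_real (g x))
            + c3 * complex_of_real (g (x - a))
            + c4 * complex_of_real (g (x - b)) = 0"
  have meas: "g \<in> borel_measurable borel" using g_meas by simp
  have nz: "\<not> (AE x in lborel. g x = 0)"
  proof
    assume "AE x in lborel. g x = 0"
    then have "AE x in lborel. (g x)\<^sup>2 = 0" by simp
    then have "(LINT x|lborel. (g x)\<^sup>2) = 0" by (rule integral_eq_zero_AE)
    with g_norm show False by simp
  qed
  have c2: "c2 = 0"
    using hrt_modulation_coeff_zero[OF meas g_L2 nz \<open>a \<noteq> b\<close> rel[folded e2pi_def]] .
  have indep: "\<alpha> = 0 \<and> \<beta> = 0 \<and> \<gamma> = 0"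
    if "AE x in lborel. \<alpha> * g x + \<beta> * g (x - a) + \<gamma> * g (x - b) = 0" for \<alpha> \<beta> \<gamma>
    using three_translates_independent[OF meas g_L2 nz, of "-a" "-b" \<alpha> \<beta> \<gamma>] that assms(4-6) by simp
  \<comment> \<open>Once the modulated term is gone, all functions are real and the relation splits
    into two real ones among translates.\<close>
  have "AE x in lborel. Re c1 * g x + Re c3 * g (x - a) + Re c4 * g (x - b) = 0"
    using rel by eventually_elim (simp add: c2 complex_eq_iff)
  moreover have "AE x in lborel. Im c1 * g x + Im c3 * g (x - a) + Im c4 * g (x - b) = 0"
    using rel by eventually_elim (simp add: c2 complex_eq_iff)
  ultimately show "c1 = 0 \<and> c2 = 0 \<and> c3 = 0 \<and> c4 = 0"
    using c2 by (auto dest!: indep simp: complex_eq_iff)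
qed

end
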